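(* Let $1<p<\infty$. Define the following measures over $\Gamma_\pm$: $$d\xi_\pm(y)=\min(\tau_\mp(y),1)\,d\mu_\pm(y),\qquad y\in\Gamma_\pm,$$ and set $Y_p^\pm:=L^p(\Gamma_\pm,\xi_\pm)$ with its usual norm. Then, for any $f\in\mathscr{D}(\mathcal{T}_{\max,p})$, the trace $\mathsf{B}^\pm f$ belongs to $Y_p^\pm$ with $$\|\mathsf{B}^\pm f\|_{Y_p^\pm}^p\leq2^{p-1}\left(\|f\|_p^p+\|\mathcal{T}_{\max,p}f\|_p^p\right),\qquad f\in\mathscr{D}(\mathcal{T}_{\max,p}),$$ where $\|\cdot\|_p$ is the norm of $L^p(\Omega,\mu)$.
   Context: Setting. $\mathbb{R}^N$ is endowed with a positive Radon measure $\mu$, $\Omega\subset\mathbb{R}^N$ is a sufficiently smooth open set, $\mathscr{F}:\mathbb{R}^N\to\mathbb{R}^N$ is a globally Lipschitz vector field, and $\Phi:\mathbb{R}^N\times\mathbb{R}\to\mathbb{R}^N$ is its flow: $t\mapsto\Phi(x,t)$ is the unique solution of $\dot{\mathbf X}=\mathscr{F}(\mathbf X)$, $\mathbf X(0)=x$. With $T_t=\Phi(\cdot,t)$, it is assumed that $\mu(T_tA)=\mu(A)$ for all measurable $A\subset\mathbb{R}^N$ and all $t\in\mathbb{R}$. Functions are real-valued. For $x\in\Omega$, $\tau_\pm(x)=\inf\{s>0:\Phi(x,\pm s)\notin\Omega\}$ ($\inf\varnothing=\infty$); $\Omega_\pm=\{x\in\Omega:\tau_\pm(x)<\infty\}$,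 $\Omega_{\pm\infty}=\Omega\setminus\Omega_\pm$; $\Gamma_\pm=\{y\in\partial\Omega:\exists x\in\Omega,\ \tau_\pm(x)<\infty,\ y=\Phi(x,\pm\tau_\pm(x))\}$. For $y\in\Gamma_\pm$, $\tau_\mp(y)=\inf\{s>0:\Phi(y,\mp s)\notin\Omega\}$, and $\Gamma_{\pm\infty}=\{y\in\Gamma_\pm:\tau_\mp(y)=\infty\}$. $\mu_\pm$ are the unique positive Borel measures on $\Gamma_\pm$ such that for all $h\in L^1(\Omega,\mu)$, $\int_{\Omega_\pm}h\,d\mu=\int_{\Gamma_\pm}d\mu_\pm(y)\int_0^{\tau_\mp(y)}h(\Phi(y,\mp s))\,ds$ and $\int_{\Omega_\pm\cap\Omega_{\mp\infty}}h\,d\mu=\int_{\Gamma_{\pm\infty}}d\mu_\pm(y)\int_0^\infty h(\Phi(y,\mp s))\,ds$. Test functions: $\mathfrak{Y}$ is the set of measurable bounded $\psi:\Omega\to\mathbb{R}$ with compact support in $\Omega$ such that for any $x\in\Omega$ the map $s\in(-\tau_-(x),\tau_+(x))\mapsto\psi(\Phi(x,s))$ is $C^1$ and $x\mapsto\frac{d}{ds}\psi(\Phi(x,s))|_{s=0}$ is measurable and bounded. $\mathscr{D}(\mathcal{T}_{\max,p})$ is the set of $f\in L^p(\Omega,\mu)$ for which there is $g\in L^p(\Omega,\mu)$ with $\int_\Omega g\psi\,d\mu=\int_\Omega f(x)\frac{d}{ds}\psi(\Phi(x,s))|_{s=0}\,d\mu(x)$ for all $\psi\in\mathfrak{Y}$;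 then $\mathcal{T}_{\max,p}f:=g$. Traces: every $f\in\mathscr{D}(\mathcal{T}_{\max,p})$ has a representative $f^\sharp$ with $f^\sharp(\Phi(x,t_1))-f^\sharp(\Phi(x,t_2))=\int_{t_1}^{t_2}[\mathcal{T}_{\max,p}f](\Phi(x,s))\,ds$ for $\mu$-a.e. $x\in\Omega$ and all $-\tau_-(x)<t_1\leq t_2<\tau_+(x)$, and the limits $\mathsf{B}^\pm f(y):=\lim_{t\to0+}f^\sharp(\Phi(y,\mp t))$ exist for $\mu_\pm$-a.e. $y\in\Gamma_\pm$. *)

theory Defs
  imports "HOL-Analysis.Analysis"
begin

text \<open>
  A sign \<open>\<sigma> \<in> {1, -1}\<close> replaces the subscript of all the paired objects: \<open>\<sigma> = 1\<close> gives
  \<open>\<tau>\<^sub>+\<close>, \<open>\<Omega>\<^sub>+\<close>, \<open>\<Gamma>\<^sub>+\<close>, \<open>\<mu>\<^sub>+\<close>, \<open>\<xi>\<^sub>+\<close>, \<open>B\<^sup>+\<close>, and \<open>\<sigma> = -1\<close> gives \<open>\<tau>\<^sub>-\<close>, \<open>\<Omega>\<^sub>-\<close>, and so on.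
  Functions on \<open>\<Omega>\<close> or on the boundary are total functions whose values elsewhere play no role.
\<close>

text \<open>On Euclidean space every Borel measure that is finite on compact sets is regular, so
  regularity is not part of the definition.\<close>

definition radon_measure :: "'a::euclidean_space measure \<Rightarrow> bool" where
  "radon_measure \<mu> \<longleftrightarrow>
     sets \<mu> = sets borel \<and> (\<forall>K. compact K \<longrightarrow> emeasure \<mu> K < \<infinity>)"

text \<open>For globally Lipschitz \<open>F\<close> this determines \<open>\<Phi>\<close>.\<close>

definition is_flow :: "('a::euclidean_space \<Rightarrow> 'a) \<Rightarrow> ('a \<Rightarrow> real \<Rightarrow> 'a) \<Rightarrow> bool" where
  "is_flow F \<Phi> \<longleftrightarrow>
     (\<forall>x. \<Phi> x 0 = x \<and> (\<forall>t. ((\<lambda>s. \<Phi> x s) has_vector_derivative F (\<Phi> x t)) (at t)))"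

definition flow_preserves :: "'a::euclidean_space measure \<Rightarrow> ('a \<Rightarrow> real \<Rightarrow> 'a) \<Rightarrow> bool" where
  "flow_preserves \<mu> \<Phi> \<longleftrightarrow>
     (\<forall>A\<in>sets borel. \<forall>t. emeasure \<mu> ((\<lambda>x. \<Phi> x t) ` A) = emeasure \<mu> A)"


subsection \<open>Exit times and the parts of the boundary\<close>

definition exit_time :: "('a::euclidean_space \<Rightarrow> real \<Rightarrow> 'a) \<Rightarrow> 'a set \<Rightarrow> real \<Rightarrow> 'a \<Rightarrow> ereal" where
  "exit_time \<Phi> \<Omega> \<sigma> x = Inf (ereal ` {s. 0 < s \<and> \<Phi> x (\<sigma> * s) \<notin> \<Omega>})"

definition Omega_fin :: "('a::euclidean_space \<Rightarrow> real \<Rightarrow> 'a) \<Rightarrow> 'a set \<Rightarrow> real \<Rightarrow> 'a set" where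
  "Omega_fin \<Phi> \<Omega> \<sigma> = {x \<in> \<Omega>. exit_time \<Phi> \<Omega> \<sigma> x < \<infinity>}"

definition Omega_inf :: "('a::euclidean_space \<Rightarrow> real \<Rightarrow> 'a) \<Rightarrow> 'a set \<Rightarrow> real \<Rightarrow> 'a set" where
  "Omega_inf \<Phi> \<Omega> \<sigma> = \<Omega> - Omega_fin \<Phi> \<Omega> \<sigma>"

definition Gamma :: "('a::euclidean_space \<Rightarrow> real \<Rightarrow> 'a) \<Rightarrow> 'a set \<Rightarrow> real \<Rightarrow> 'a set" where
  "Gamma \<Phi> \<Omega> \<sigma> =
     {y \<in> frontier \<Omega>. \<exists>x\<in>\<Omega>. exit_time \<Phi> \<Omega> \<sigma> x < \<infinity> \<and>
                          y = \<Phi> x (\<sigma> * real_of_ereal (exit_time \<Phi> \<Omega> \<sigma> x))}"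

definition Gamma_inf :: "('a::euclidean_space \<Rightarrow> real \<Rightarrow> 'a) \<Rightarrow> 'a set \<Rightarrow> real \<Rightarrow> 'a set" where
  "Gamma_inf \<Phi> \<Omega> \<sigma> = {y \<in> Gamma \<Phi> \<Omega> \<sigma>. exit_time \<Phi> \<Omega> (- \<sigma>) y = \<infinity>}"

text \<open>The defining property of \<open>\<mu>\<^sub>\<plusminus>\<close>. Since the Bochner integral of a non-integrable function
  is 0 by convention, the integrability that is implicit in the iterated integral is spelled
  out.\<close>

definition boundary_measure ::
  "'a::euclidean_space measure \<Rightarrow> ('a \<Rightarrow> real \<Rightarrow> 'a) \<Rightarrow> 'a set \<Rightarrow> real \<Rightarrow> 'a measure \<Rightarrow> bool" where
  "boundary_measure \<mu> \<Phi> \<Omega> \<sigma> \<nu> \<longleftrightarrow>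
     space \<nu> = Gamma \<Phi> \<Omega> \<sigma> \<and>
     sets \<nu> = sets (restrict_space borel (Gamma \<Phi> \<Omega> \<sigma>)) \<and>
     (\<forall>h :: 'a \<Rightarrow> real. set_integrable \<mu> \<Omega> h \<longrightarrow>
        (AE y in \<nu>. set_integrable lborel {s. 0 < s \<and> ereal s < exit_time \<Phi> \<Omega> (- \<sigma>) y}
                      (\<lambda>s. h (\<Phi> y (- \<sigma> * s)))) \<and>
        integrable \<nu> (\<lambda>y. LINT s:{s. 0 < s \<and> ereal s < exit_time \<Phi> \<Omega> (- \<sigma>) y}|lborel.
                              h (\<Phi> y (- \<sigma> * s))) \<and>
        (LINT x:Omega_fin \<Phi> \<Omega> \<sigma>|\<mu>. h x) =
          (LINT y|\<nu>. (LINT s:{s. 0 < s \<and> ereal s < exit_time \<Phi> \<Omega> (- \<sigma>) y}|lborel.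
                          h (\<Phi> y (- \<sigma> * s)))) \<and>
        (LINT x:Omega_fin \<Phi> \<Omega> \<sigma> \<inter> Omega_inf \<Phi> \<Omega> (- \<sigma>)|\<mu>. h x) =
          (LINT y:Gamma_inf \<Phi> \<Omega> \<sigma>|\<nu>. (LINT s:{0<..}|lborel. h (\<Phi> y (- \<sigma> * s)))))"

definition xi :: "('a::euclidean_space \<Rightarrow> real \<Rightarrow> 'a) \<Rightarrow> 'a set \<Rightarrow> real \<Rightarrow> 'a measure \<Rightarrow> 'a measure" where
  "xi \<Phi> \<Omega> \<sigma> \<nu> = density \<nu> (\<lambda>y. e2ennreal (min (exit_time \<Phi> \<Omega> (- \<sigma>) y) 1))"


subsection \<open>Lebesgue spaces\<close>

text \<open>The completion makes membership and norm depend only on the almost-everywhere class of the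
  function; this matters for traces, which are defined only almost everywhere.\<close>

definition Lp :: "real \<Rightarrow> 'a measure \<Rightarrow> ('a \<Rightarrow> real) set" where
  "Lp p M = {f \<in> borel_measurable (completion M). integrable (completion M) (\<lambda>x. \<bar>f x\<bar> powr p)}"

definition Lp_norm :: "real \<Rightarrow> 'a measure \<Rightarrow> ('a \<Rightarrow> real) \<Rightarrow> real" where
  "Lp_norm p M f = (LINT x|completion M. \<bar>f x\<bar> powr p) powr (1 / p)"


subsection \<open>The maximal transport operator\<close>

definition flow_deriv :: "('a::euclidean_space \<Rightarrow> real \<Rightarrow> 'a) \<Rightarrow> ('a \<Rightarrow> real) \<Rightarrow> 'a \<Rightarrow> real" where
  "flow_deriv \<Phi> \<psi> x = deriv (\<lambda>s. \<psi> (\<Phi> x s)) 0"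

definition trajectory_interval ::
  "('a::euclidean_space \<Rightarrow> real \<Rightarrow> 'a) \<Rightarrow> 'a set \<Rightarrow> 'a \<Rightarrow> real set" where
  "trajectory_interval \<Phi> \<Omega> x =
     {s. - exit_time \<Phi> \<Omega> (- 1) x < ereal s \<and> ereal s < exit_time \<Phi> \<Omega> 1 x}"

definition test_functions ::
  "('a::euclidean_space \<Rightarrow> real \<Rightarrow> 'a) \<Rightarrow> 'a set \<Rightarrow> ('a \<Rightarrow> real) set" where
  "test_functions \<Phi> \<Omega> =
     {\<psi>. \<psi> \<in> borel_measurable (restrict_space borel \<Omega>) \<and> bounded (\<psi> ` \<Omega>) \<and>
          compact (closure {x \<in> \<Omega>. \<psi> x \<noteq> 0}) \<and> closure {x \<in> \<Omega>. \<psi> x \<noteq> 0} \<subseteq> \<Omega> \<and>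
          (\<forall>x\<in>\<Omega>. (\<lambda>s. \<psi> (\<Phi> x s)) C1_differentiable_on trajectory_interval \<Phi> \<Omega> x) \<and>
          flow_deriv \<Phi> \<psi> \<in> borel_measurable (restrict_space borel \<Omega>) \<and>
          bounded (flow_deriv \<Phi> \<psi> ` \<Omega>)}"

definition weak_transport ::
  "'a::euclidean_space measure \<Rightarrow> ('a \<Rightarrow> real \<Rightarrow> 'a) \<Rightarrow> 'a set \<Rightarrow> real \<Rightarrow>
     ('a \<Rightarrow> real) \<Rightarrow> ('a \<Rightarrow> real) \<Rightarrow> bool" where
  "weak_transport \<mu> \<Phi> \<Omega> p f g \<longleftrightarrow>
     g \<in> Lp p (restrict_space \<mu> \<Omega>) \<and>
     (\<forall>\<psi>\<in>test_functions \<Phi> \<Omega>.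
        (LINT x|completion (restrict_space \<mu> \<Omega>). g x * \<psi> x) =
        (LINT x|completion (restrict_space \<mu> \<Omega>). f x * flow_deriv \<Phi> \<psi> x))"

definition Tmax_dom ::
  "'a::euclidean_space measure \<Rightarrow> ('a \<Rightarrow> real \<Rightarrow> 'a) \<Rightarrow> 'a set \<Rightarrow> real \<Rightarrow> ('a \<Rightarrow> real) set" where
  "Tmax_dom \<mu> \<Phi> \<Omega> p = {f \<in> Lp p (restrict_space \<mu> \<Omega>). \<exists>g. weak_transport \<mu> \<Phi> \<Omega> p f g}"

text \<open>The function \<open>g\<close> is unique up to \<open>\<mu>\<close>-null sets; the choice below only selects a
  representative.\<close>

definition Tmax ::
  "'a::euclidean_space measure \<Rightarrow> ('a \<Rightarrow> real \<Rightarrow> 'a) \<Rightarrow> 'a set \<Rightarrow> real \<Rightarrow> ('a \<Rightarrow> real) \<Rightarrow> ('a \<Rightarrow> real)" where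
  "Tmax \<mu> \<Phi> \<Omega> p f = (SOME g. weak_transport \<mu> \<Phi> \<Omega> p f g)"


subsection \<open>Traces\<close>

text \<open>\<open>fs\<close> is a representative \<open>f\<^sup>\<sharp>\<close> of \<open>f\<close> that is absolutely continuous along the
  trajectories. The minus sign (\<open>t1\<close> before \<open>t2\<close>) comes from \<open>T f = - F \<bullet> \<nabla> f\<close>. The slices
  of a merely \<open>\<mu>\<close>-measurable function need not be Borel, hence \<open>lebesgue\<close>.\<close>

definition sharp_rep ::
  "'a::euclidean_space measure \<Rightarrow> ('a \<Rightarrow> real \<Rightarrow> 'a) \<Rightarrow> 'a set \<Rightarrow> real \<Rightarrow>
     ('a \<Rightarrow> real) \<Rightarrow> ('a \<Rightarrow> real) \<Rightarrow> bool" where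
  "sharp_rep \<mu> \<Phi> \<Omega> p f fs \<longleftrightarrow>
     (AE x in restrict_space \<mu> \<Omega>. fs x = f x) \<and>
     (AE x in restrict_space \<mu> \<Omega>. \<forall>t1 t2.
        - exit_time \<Phi> \<Omega> (- 1) x < ereal t1 \<and> t1 \<le> t2 \<and> ereal t2 < exit_time \<Phi> \<Omega> 1 x \<longrightarrow>
          set_integrable lebesgue {t1..t2} (\<lambda>s. Tmax \<mu> \<Phi> \<Omega> p f (\<Phi> x s)) \<and>
          fs (\<Phi> x t1) - fs (\<Phi> x t2) = (LINT s:{t1..t2}|lebesgue. Tmax \<mu> \<Phi> \<Omega> p f (\<Phi> x s)))"

definition trace_exists ::
  "('a::euclidean_space \<Rightarrow> real \<Rightarrow> 'a) \<Rightarrow> real \<Rightarrow> ('a \<Rightarrow> real) \<Rightarrow> 'a \<Rightarrow> bool" where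
  "trace_exists \<Phi> \<sigma> fs y \<longleftrightarrow> (\<exists>l. ((\<lambda>t. fs (\<Phi> y (- \<sigma> * t))) \<longlongrightarrow> l) (at_right 0))"

definition flow_trace :: "('a::euclidean_space \<Rightarrow> real \<Rightarrow> 'a) \<Rightarrow> real \<Rightarrow> ('a \<Rightarrow> real) \<Rightarrow> 'a \<Rightarrow> real" where
  "flow_trace \<Phi> \<sigma> fs y = Lim (at_right 0) (\<lambda>t. fs (\<Phi> y (- \<sigma> * t)))"

end

theory Submission
  imports Defs
begin

text \<open>
  The estimate is a one-dimensional trace inequality on each characteristic curve, integrated over
  the boundary.

  Fix \<open>y \<in> \<Gamma>\<^sub>\<sigma>\<close>, follow the flow from \<open>y\<close> into \<open>\<Omega>\<close> (backwards from an exit point if \<open>\<sigma> = 1\<close>,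
  forwards from an entry point if \<open>\<sigma> = -1\<close>), and put
  \<open>u(s) = f\<^sup>\<sharp>(\<Phi>(y, -\<sigma>s))\<close>, \<open>v(s) = (T f)(\<Phi>(y, -\<sigma>s))\<close> and \<open>\<tau> = \<tau>\<^sub>-\<^sub>\<sigma>(y)\<close>, which is positive.
  For almost every \<open>y\<close> the representative satisfies \<open>u(s\<^sub>2) - u(s\<^sub>1) = \<sigma> \<integral>\<^bsub>s\<^sub>1\<^esub>\<^bsup>s\<^sub>2\<^esup> v\<close> on \<open>(0, \<tau>)\<close>, and both
  \<open>|u|\<^sup>p\<close> and \<open>|v|\<^sup>p\<close> are integrable there. Cut the interval to \<open>(0, T)\<close> with \<open>T = min(\<tau>, 1)\<close>. On a
  bounded interval \<open>v\<close> itself is integrable, so \<open>u\<close> has a limit \<open>l\<close> at \<open>0\<close>, and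
  \<open>|l| \<le> |u(t)| + \<integral>\<^sub>0\<^sup>T |v|\<close> for every \<open>t\<close>. Convexity of the \<open>p\<close>-th power together with Jensen's
  inequality (where \<open>T \<le> 1\<close> absorbs the constant) gives
  \<open>|l|\<^sup>p \<le> 2\<^bsup>p-1\<^esup> (|u(t)|\<^sup>p + \<integral>\<^sub>0\<^sup>T |v|\<^sup>p)\<close>. Integrating over \<open>t \<in> (0, T)\<close> produces the weight of \<open>\<xi>\<^sub>\<sigma>\<close>:
  \<open>T |l|\<^sup>p \<le> 2\<^bsup>p-1\<^esup> (\<integral>\<^sub>0\<^sup>\<tau> |u|\<^sup>p + \<integral>\<^sub>0\<^sup>\<tau> |v|\<^sup>p)\<close>. This is \<open>endpoint_trace\<close>. Integrating in \<open>y\<close>, the defining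
  property of \<open>\<mu>\<^sub>\<sigma>\<close> turns the right-hand side into integrals over \<open>\<Omega>\<^sub>\<sigma> \<subseteq> \<Omega>\<close>.

  Two measure-theoretic points need care. The identities for \<open>f\<^sup>\<sharp>\<close> hold only outside \<open>\<mu>\<close>-null sets, and
  \<open>boundary_measure_AE_slices\<close> transfers them to almost every point of almost every curve, by applying
  the defining property of \<open>\<mu>\<^sub>\<sigma>\<close> to the indicator of the null set. The trace, a pointwise limit over a
  continuous parameter, is not visibly measurable; but averaging \<open>l = u(t) - \<sigma> \<integral>\<^sub>0\<^sup>t v\<close> over \<open>t\<close> writes
  it, almost everywhere, as an iterated integral of Borel functions of \<open>y\<close>
  (\<open>slice_average_measurable\<close>). That in turn rests on the joint continuity of the flow, which comes from
  Gronwall's inequality.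
\<close>

section \<open>Flows of Lipschitz vector fields\<close>

text \<open>Gronwall's inequality in differential form: \<open>|X - Y|\<^sup>2\<close> multiplied by \<open>e\<^bsup>-2Lt\<^esup>\<close> decreases.\<close>

lemma lipschitz_ode_dist_le_forward:
  fixes F :: "'a::real_inner \<Rightarrow> 'a"
  assumes L: "L-lipschitz_on UNIV F"
    and X: "\<And>t. (X has_vector_derivative F (X t)) (at t)"
    and Y: "\<And>t. (Y has_vector_derivative F (Y t)) (at t)"
    and t: "0 \<le> t"
  shows "norm (X t - Y t) \<le> exp (L * t) * norm (X 0 - Y 0)"
proof -
  define e where "e = (\<lambda>t. ((X t - Y t) \<bullet> (X t - Y t)) * exp (- (2 * L * t)))"
  have D: "(e has_real_derivative
      (2 * ((X s - Y s) \<bullet> (F (X s) - F (Y s))) - 2 * L * ((X s - Y s) \<bullet> (X s - Y s)))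
        * exp (- (2 * L * s))) (at s)" for s
    unfolding e_def has_real_derivative_iff_has_vector_derivative
    by (rule has_vector_derivative_eq_rhs,
        (rule derivative_intros X Y refl bounded_bilinear.has_vector_derivative[OF bounded_bilinear_inner]
          has_vector_derivative_real_field | rule has_real_derivative_iff_has_vector_derivative[THEN iffD1])+)
       (auto simp: algebra_simps inner_commute)
  have nonpos: "(2 * ((X s - Y s) \<bullet> (F (X s) - F (Y s))) - 2 * L * ((X s - Y s) \<bullet> (X s - Y s)))
        * exp (- (2 * L * s)) \<le> 0" for s
  proof -
    have "(X s - Y s) \<bullet> (F (X s) - F (Y s)) \<le> norm (X s - Y s) * norm (F (X s) - F (Y s))"
      by (rule norm_cauchy_schwarz)
    also have "\<dots> \<le> norm (X s - Y s) * (L * norm (X s - Y s))"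
      using lipschitz_onD[OF L, of "X s" "Y s"] by (intro mult_left_mono) (auto simp: dist_norm)
    also have "\<dots> = L * ((X s - Y s) \<bullet> (X s - Y s))"
      by (simp add: dot_square_norm power2_eq_square)
    finally show ?thesis by (intro mult_nonpos_nonneg) auto
  qed
  have "e t \<le> e 0"
    by (rule DERIV_nonpos_imp_nonincreasing[OF t]) (use D nonpos in blast)
  then have "(norm (X t - Y t))\<^sup>2 * exp (- (2 * L * t)) \<le> (norm (X 0 - Y 0))\<^sup>2"
    by (simp add: e_def dot_square_norm)
  then have "(norm (X t - Y t))\<^sup>2 \<le> (norm (X 0 - Y 0))\<^sup>2 * exp (2 * L * t)"
    by (simp add: exp_minus field_simps)
  also have "\<dots> = (exp (L * t) * norm (X 0 - Y 0))\<^sup>2"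
    by (simp add: power_mult_distrib exp_double[symmetric] algebra_simps)
  finally show ?thesis by (rule power2_le_imp_le) simp
qed

text \<open>Negative times reduce to positive ones by reversing time, which replaces \<open>F\<close> by \<open>-F\<close>.\<close>

lemma lipschitz_ode_dist_le:
  fixes F :: "'a::real_inner \<Rightarrow> 'a"
  assumes L: "L-lipschitz_on UNIV F"
    and X: "\<And>t. (X has_vector_derivative F (X t)) (at t)"
    and Y: "\<And>t. (Y has_vector_derivative F (Y t)) (at t)"
  shows "norm (X t - Y t) \<le> exp (L * \<bar>t\<bar>) * norm (X 0 - Y 0)"
proof (cases "0 \<le> t")
  case True
  then show ?thesis using lipschitz_ode_dist_le_forward[OF L X Y] by simp
next
  case False
  have rev: "((\<lambda>t. Z (- t)) has_vector_derivative - F (Z (- t))) (at t)"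
    if "\<And>t. (Z has_vector_derivative F (Z t)) (at t)" for Z :: "real \<Rightarrow> 'a" and t
  proof -
    have "(uminus has_real_derivative - 1) (at t)" by (auto intro!: derivative_eq_intros)
    from vector_diff_chain_at[OF this[unfolded has_real_derivative_iff_has_vector_derivative] that]
    show ?thesis by (simp add: o_def)
  qed
  have L': "L-lipschitz_on UNIV (\<lambda>x. - F x)"
    using L by (auto simp: lipschitz_on_def dist_minus)
  show ?thesis
    using lipschitz_ode_dist_le_forward[OF L' rev[OF X] rev[OF Y], of "- t"] False by simp
qed

locale lipschitz_flow =
  fixes F :: "'a::euclidean_space \<Rightarrow> 'a" and \<Phi> :: "'a \<Rightarrow> real \<Rightarrow> 'a" and L :: real
  assumes lipschitz: "L-lipschitz_on UNIV F" and flow: "is_flow F \<Phi>"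
begin

lemma flow_0 [simp]: "\<Phi> x 0 = x"
  and flow_has_derivative: "(\<Phi> x has_vector_derivative F (\<Phi> x t)) (at t)"
  using flow unfolding is_flow_def by auto

text \<open>Both sides solve the equation with initial value \<open>\<Phi> x s\<close>, so this is uniqueness.\<close>

lemma flow_add: "\<Phi> (\<Phi> x s) t = \<Phi> x (s + t)"
proof -
  have "((\<lambda>t. \<Phi> x (s + t)) has_vector_derivative F (\<Phi> x (s + t))) (at t)" for t
  proof -
    have "((+) s has_real_derivative 1) (at t)" by (auto intro!: derivative_eq_intros)
    from vector_diff_chain_at[OF this[unfolded has_real_derivative_iff_has_vector_derivative]
        flow_has_derivative]
    show ?thesis by (simp add: o_def)
  qed
  from lipschitz_ode_dist_le[OF lipschitz flow_has_derivative this, of "\<Phi> x s" t] show ?thesis by simp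
qed

lemma continuous_flow: "continuous_on UNIV (\<lambda>z. \<Phi> (fst z) (snd z))"
proof -
  have "((\<lambda>z. \<Phi> (fst z) (snd z)) \<longlongrightarrow> \<Phi> x0 t0) (at (x0, t0))" for x0 t0
  proof (rule Lim_transform)
    \<comment> \<open>Compare with the trajectory of \<open>x0\<close>, along which only continuity in time is needed;
      Gronwall controls the rest.\<close>
    have "isCont (\<Phi> x0) t0"
      using flow_has_derivative by (rule has_vector_derivative_continuous)
    then have "isCont (\<lambda>z :: 'a \<times> real. \<Phi> x0 (snd z)) (x0, t0)"
      by (intro isCont_o2[where f = snd and g = "\<Phi> x0"]) auto
    then show "((\<lambda>z. \<Phi> x0 (snd z)) \<longlongrightarrow> \<Phi> x0 t0) (at (x0, t0))"
      by (simp add: isCont_def)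
    have "((\<lambda>z. exp (L * \<bar>snd z\<bar>) * norm (fst z - x0)) \<longlongrightarrow> exp (L * \<bar>snd (x0, t0)\<bar>) * norm (fst (x0, t0) - x0)) (at (x0, t0))"
      by (intro tendsto_intros)
    then have lim: "((\<lambda>z. exp (L * \<bar>snd z\<bar>) * norm (fst z - x0)) \<longlongrightarrow> 0) (at (x0, t0))"
      by simp
    show "((\<lambda>z. \<Phi> (fst z) (snd z) - \<Phi> x0 (snd z)) \<longlongrightarrow> 0) (at (x0, t0))"
    proof (rule Lim_null_comparison[OF always_eventually lim], rule allI)
      fix z :: "'a \<times> real"
      show "norm (\<Phi> (fst z) (snd z) - \<Phi> x0 (snd z)) \<le> exp (L * \<bar>snd z\<bar>) * norm (fst z - x0)"
        using lipschitz_ode_dist_le[OF lipschitz flow_has_derivative flow_has_derivative, of x0 "snd z" "fst z"]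
        by (simp add: case_prod_beta norm_minus_commute)
    qed
  qed
  then show ?thesis by (auto simp: continuous_on_def)
qed

lemma continuous_flow_time: "continuous_on UNIV (\<Phi> x)"
  by (intro continuous_at_imp_continuous_on ballI
      has_vector_derivative_continuous[OF flow_has_derivative])

lemma flow_measurable [measurable (raw)]:
  assumes [measurable]: "g \<in> borel_measurable M" "h \<in> borel_measurable M"
  shows "(\<lambda>x. \<Phi> (g x) (h x)) \<in> borel_measurable M"
  by (rule borel_measurable_continuous_Pair[OF assms continuous_flow])

section \<open>Exit times\<close>

lemma exit_time_less_iff:
  "exit_time \<Phi> \<Omega> \<sigma> y < a \<longleftrightarrow> (\<exists>s>0. ereal s < a \<and> \<Phi> y (\<sigma> * s) \<notin> \<Omega>)"
  unfolding exit_time_def by (auto simp: Inf_less_iff)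

lemma exit_time_nonneg: "0 \<le> exit_time \<Phi> \<Omega> \<sigma> x"
  unfolding exit_time_def by (auto intro!: Inf_greatest)

lemma flow_inside: "0 < s \<Longrightarrow> ereal s < exit_time \<Phi> \<Omega> \<sigma> y \<Longrightarrow> \<Phi> y (\<sigma> * s) \<in> \<Omega>"
  using exit_time_less_iff[of \<Omega> \<sigma> y "exit_time \<Phi> \<Omega> \<sigma> y"] by auto

lemma exit_time_geI:
  assumes "\<And>s. 0 < s \<Longrightarrow> ereal s < a \<Longrightarrow> \<Phi> y (\<sigma> * s) \<in> \<Omega>"
  shows "a \<le> exit_time \<Phi> \<Omega> \<sigma> y"
  using assms exit_time_less_iff[of \<Omega> \<sigma> y a] by (meson linorder_not_less)

text \<open>Leaving \<open>\<Omega>\<close> before time \<open>a\<close> means meeting the closed complement of \<open>\<Omega>\<close> during one of countably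
  many compact time intervals, and the set of starting points that do so within a given compact
  interval is the projection of a closed set along a compact factor, hence closed.\<close>

lemma exit_time_measurable:
  assumes "open \<Omega>"
  shows "exit_time \<Phi> \<Omega> \<sigma> \<in> borel_measurable borel"
proof (rule borel_measurableI_less)
  fix a :: ereal
  define K where "K q n = {y. \<exists>s. s \<in> {1 / real (Suc n) .. q} \<and> (s, y) \<in> {(s, y). \<Phi> y (\<sigma> * s) \<in> - \<Omega>}}"
    for q :: real and n
  have "continuous_on UNIV (\<lambda>z. \<Phi> (snd z) (\<sigma> * fst z))"
    using continuous_on_compose2[OF continuous_flow, where f = "\<lambda>z. (snd z, \<sigma> * fst z)" and s = UNIV]
    by (simp add: continuous_intros)
  then have "closed ((\<lambda>z. \<Phi> (snd z) (\<sigma> * fst z)) -` (- \<Omega>))"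
    using assms by (intro closed_vimage closed_Compl)
  also have "(\<lambda>z. \<Phi> (snd z) (\<sigma> * fst z)) -` (- \<Omega>) = {(s, y). \<Phi> y (\<sigma> * s) \<in> - \<Omega>}"
    by auto
  finally have "closed {(s, y). \<Phi> y (\<sigma> * s) \<in> - \<Omega>}" .
  then have K: "closed (K q n)" for q n
    unfolding K_def by (intro closed_compact_projection) auto
  have "{y. exit_time \<Phi> \<Omega> \<sigma> y < a} = (\<Union>q\<in>{q \<in> \<rat>. ereal q < a}. \<Union>n. K q n)"
  proof (intro set_eqI iffI)
    fix y assume "y \<in> {y. exit_time \<Phi> \<Omega> \<sigma> y < a}"
    then obtain s where s: "s > 0" "ereal s < a" "\<Phi> y (\<sigma> * s) \<notin> \<Omega>"
      by (auto simp: exit_time_less_iff)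
    obtain r where r: "s < r" "ereal r < a"
      using ereal_dense2[OF s(2)] by auto
    obtain q where q: "q \<in> \<rat>" "s < q" "q < r" using Rats_dense_in_real[OF r(1)] by auto
    have "ereal q < a" using q r by (meson ereal_less_eq(3) le_less_trans less_le)
    moreover obtain n where "1 / real (Suc n) < s"
      using nat_approx_posE[OF s(1)] by auto
    with s q have "y \<in> K q n"
      unfolding K_def by (intro CollectI exI[of _ s]) simp
    ultimately show "y \<in> (\<Union>q\<in>{q \<in> \<rat>. ereal q < a}. \<Union>n. K q n)"
      using q(1) by blast
  next
    fix y assume "y \<in> (\<Union>q\<in>{q \<in> \<rat>. ereal q < a}. \<Union>n. K q n)"
    then obtain q n s where *: "ereal q < a" "1 / real (Suc n) \<le> s" "s \<le> q" "\<Phi> y (\<sigma> * s) \<notin> \<Omega>"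
      by (auto simp: K_def)
    have "0 < 1 / real (Suc n)" by simp
    with *(2) have "0 < s" by linarith
    moreover have "ereal s < a" using *(1,3) by (meson ereal_less_eq(3) le_less_trans)
    ultimately show "y \<in> {y. exit_time \<Phi> \<Omega> \<sigma> y < a}" using *(4) by (auto simp: exit_time_less_iff)
  qed
  moreover have "(\<Union>q\<in>{q \<in> \<rat>. ereal q < a}. \<Union>n. K q n) \<in> sets borel"
  proof (rule sets.countable_UN')
    show "countable {q \<in> \<rat>. ereal q < a}" by (rule countable_subset[OF _ countable_rat]) auto
    show "(\<lambda>q. \<Union>n. K q n) ` {q \<in> \<rat>. ereal q < a} \<subseteq> sets borel"
      using borel_closed[OF K] by blast
  qed
  ultimately show "{x \<in> space borel. exit_time \<Phi> \<Omega> \<sigma> x < a} \<in> sets borel" by simp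
qed

text \<open>The trajectory that ends in \<open>y\<close> spent a positive time in the open set \<open>\<Omega>\<close> before, and this time is
  available when it is run backwards from \<open>y\<close>.\<close>

lemma Gamma_exit_time_pos:
  assumes \<Omega>: "open \<Omega>" and y: "y \<in> Gamma \<Phi> \<Omega> \<sigma>"
  shows "0 < exit_time \<Phi> \<Omega> (- \<sigma>) y"
proof -
  obtain x where x: "x \<in> \<Omega>" "exit_time \<Phi> \<Omega> \<sigma> x < \<infinity>"
      "y = \<Phi> x (\<sigma> * real_of_ereal (exit_time \<Phi> \<Omega> \<sigma> x))"
    using y by (auto simp: Gamma_def)
  obtain r where r: "exit_time \<Phi> \<Omega> \<sigma> x = ereal r"
    using x(2) exit_time_nonneg[of \<Omega> \<sigma> x] by (cases "exit_time \<Phi> \<Omega> \<sigma> x") auto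
  have "open ((\<lambda>s. \<Phi> x (\<sigma> * s)) -` \<Omega>)"
    by (intro open_vimage \<Omega> continuous_on_compose2[OF continuous_flow_time] continuous_intros) auto
  then obtain e where e: "e > 0" "ball 0 e \<subseteq> (\<lambda>s. \<Phi> x (\<sigma> * s)) -` \<Omega>"
    using x(1) by (force simp: open_contains_ball)
  have "ereal e \<le> exit_time \<Phi> \<Omega> \<sigma> x"
  proof (rule exit_time_geI)
    fix s assume "0 < s" "ereal s < ereal e"
    then have "s \<in> ball 0 e" by simp
    then show "\<Phi> x (\<sigma> * s) \<in> \<Omega>" using e(2) by auto
  qed
  then have "0 < r" using e(1) r by simp
  have "ereal r \<le> exit_time \<Phi> \<Omega> (- \<sigma>) y"
  proof (rule exit_time_geI)
    fix s assume s: "0 < s" "ereal s < ereal r"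
    have "\<Phi> y (- \<sigma> * s) = \<Phi> x (\<sigma> * (r - s))"
      using x(3) r by (simp add: flow_add algebra_simps)
    also have "\<dots> \<in> \<Omega>" using s r by (intro flow_inside) auto
    finally show "\<Phi> y (- \<sigma> * s) \<in> \<Omega>" .
  qed
  then show ?thesis using \<open>0 < r\<close> by (meson ereal_less(2) less_le_trans)
qed

end

section \<open>The trace inequality on an interval\<close>

lemma powr_add_le:
  fixes a b p :: real
  assumes "1 < p" "0 \<le> a" "0 \<le> b"
  shows "(a + b) powr p \<le> 2 powr (p - 1) * (a powr p + b powr p)"
proof (cases "a = 0 \<or> b = 0")
  case True
  have "1 \<le> 2 powr (p - 1)" using assms by (simp add: ge_one_powr_ge_zero)
  then have "c powr p \<le> 2 powr (p - 1) * c powr p" for c :: real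
    using mult_right_mono[of 1 _ "c powr p"] by simp
  then show ?thesis using True assms by auto
next
  case False
  then have pos: "0 < a" "0 < b" using assms by auto
  have "((1 - 1/2) *\<^sub>R a + (1/2) *\<^sub>R b) powr p \<le> (1 - 1/2) * a powr p + (1/2) * b powr p"
    using convex_onD[OF powr_convex[of p], of "1/2" a b] pos assms by simp
  then have "((a + b) / 2) powr p \<le> (a powr p + b powr p) / 2" by (simp add: add_divide_distrib)
  then have "(a + b) powr p \<le> 2 powr p * ((a powr p + b powr p) / 2)"
    using pos by (simp add: powr_divide field_simps)
  also have "\<dots> = 2 powr (p - 1) * (a powr p + b powr p)" by (simp add: powr_diff)
  finally show ?thesis .
qed

text \<open>The tangent line of the convex function \<open>x \<mapsto> x\<^sup>p\<close> at \<open>a\<close>; the point \<open>x = 0\<close> lies outside the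
  open half-line of differentiability and is treated separately.\<close>

lemma powr_above_tangent:
  fixes a x p :: real
  assumes "1 < p" "0 < a" "0 \<le> x"
  shows "a powr p + p * a powr (p - 1) * (x - a) \<le> x powr p"
proof (cases "x = 0")
  case True
  have "a powr (p - 1) * a = a powr p" using assms by (simp add: powr_diff)
  then have "a powr p + p * a powr (p - 1) * (0 - a) = (1 - p) * a powr p"
    by (simp add: algebra_simps)
  also have "\<dots> \<le> 0" using assms by (intro mult_nonpos_nonneg) auto
  finally show ?thesis using True by simp
next
  case False
  have "((\<lambda>x. x powr p) has_real_derivative p * a powr (p - 1)) (at a within {0<..})"
    using assms by (auto intro!: derivative_eq_intros)
  from convex_on_imp_above_tangent[OF powr_convex connected_Ioi _ _ this, of x]
  show ?thesis using assms False by (simp add: interior_open)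
qed

text \<open>This makes \<open>L\<^sup>p\<close> functions integrable on sets of finite measure.\<close>

lemma powr_dominates: 
  fixes x p :: real
  assumes "1 < p" "0 \<le> x"
  shows "x \<le> 1 + x powr p"
proof (cases "x \<le> 1")
  case False
  then have "x powr 1 \<le> x powr p" using assms by (intro powr_mono) auto
  then show ?thesis using False by simp
qed (use powr_ge_zero[of x p] in linarith)

text \<open>Integrating the tangent inequality at the mean value \<open>a\<close> of \<open>|v|\<close> gives Jensen's inequality with the
  factor \<open>T\<^bsup>p-1\<^esup>\<close>, which is at most \<open>1\<close> because \<open>T \<le> 1\<close>.\<close>

lemma jensen_powr_unit_interval:
  fixes v :: "real \<Rightarrow> real"
  assumes p: "1 < p" and T: "0 < T" "T \<le> 1" and [measurable]: "v \<in> borel_measurable borel"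
    and v: "set_integrable lborel {0<..<T} (\<lambda>s. \<bar>v s\<bar> powr p)"
  shows "set_integrable lborel {0<..<T} v"
    and "(LINT s:{0<..<T}|lborel. \<bar>v s\<bar>) powr p \<le> (LINT s:{0<..<T}|lborel. \<bar>v s\<bar> powr p)"
proof -
  have const: "set_integrable lborel {0<..<T} (\<lambda>s. c)" for c :: real
    using T by (simp add: set_integrable_def)
  have constI: "(LINT s:{0<..<T}|lborel. c) = T * c" for c :: real
    using T by (simp add: set_lebesgue_integral_def)
  show v1: "set_integrable lborel {0<..<T} v"
  proof (rule set_integrable_bound[OF set_integral_add(1)[OF const[of 1] v]])
    show "set_borel_measurable lborel {0<..<T} v" by (simp add: set_borel_measurable_def)
    show "AE x in lborel. x \<in> {0<..<T} \<longrightarrow> norm (v x) \<le> norm (1 + \<bar>v x\<bar> powr p)"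
      using powr_dominates[OF p abs_ge_zero] by (auto simp: abs_of_nonneg)
  qed
  define I where "I = (LINT s:{0<..<T}|lborel. \<bar>v s\<bar>)"
  have I0: "0 \<le> I" unfolding I_def set_lebesgue_integral_def by (intro Bochner_Integration.integral_nonneg) auto
  have vp0: "0 \<le> (LINT s:{0<..<T}|lborel. \<bar>v s\<bar> powr p)"
    unfolding set_lebesgue_integral_def by (intro Bochner_Integration.integral_nonneg) auto
  show "I powr p \<le> (LINT s:{0<..<T}|lborel. \<bar>v s\<bar> powr p)"
  proof (cases "I = 0")
    case True then show ?thesis using vp0 by simp
  next
    case False
    define a where "a = I / T"
    define c where "c = p * a powr (p - 1)"
    have a: "0 < a" using False I0 T by (simp add: a_def)
    have va: "set_integrable lborel {0<..<T} (\<lambda>s. \<bar>v s\<bar>)" by (rule set_integrable_abs[OF v1])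
    have "(LINT s:{0<..<T}|lborel. (a powr p - c * a) + c * \<bar>v s\<bar>)
        \<le> (LINT s:{0<..<T}|lborel. \<bar>v s\<bar> powr p)"
      using powr_above_tangent[OF p a abs_ge_zero]
      by (intro set_integral_mono v set_integral_add(1) const set_integrable_mult_right va)
         (auto simp: c_def algebra_simps)
    also have "(LINT s:{0<..<T}|lborel. (a powr p - c * a) + c * \<bar>v s\<bar>) = T * (a powr p - c * a) + c * I"
      using va by (subst set_integral_add(2)) (auto simp: const constI I_def)
    also have "\<dots> = T * a powr p" using T by (simp add: a_def algebra_simps)
    finally have *: "T * a powr p \<le> (LINT s:{0<..<T}|lborel. \<bar>v s\<bar> powr p)" .
    have "I powr p = T powr p * a powr p" using T a by (simp add: a_def powr_divide)
    also have "\<dots> \<le> T powr 1 * a powr p"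
      using T p by (intro mult_right_mono powr_mono') auto
    also have "\<dots> = T * a powr p" using T by simp
    finally show ?thesis using * by simp
  qed
qed

text \<open>The trace inequality on one trajectory. The parameter \<open>\<kappa>\<close> is the orientation of the trajectory.
  The last conjunct expresses the limit by integrals of \<open>u0\<close> and \<open>v\<close> alone; it is what makes the limit
  depend measurably on the trajectory. The function \<open>u\<close> is the continuous representative, \<open>u0\<close> a
  measurable one.\<close>

lemma endpoint_trace:
  fixes u u0 v :: "real \<Rightarrow> real"
  assumes p: "1 < p" and T: "0 < T" "T \<le> 1" and \<kappa>: "\<bar>\<kappa>\<bar> = 1"
    and [measurable]: "u0 \<in> borel_measurable borel" "v \<in> borel_measurable borel"
    and incr: "\<And>s1 s2. 0 < s1 \<Longrightarrow> s1 \<le> s2 \<Longrightarrow> s2 < T \<Longrightarrow>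
                 u s2 - u s1 = \<kappa> * (LINT s:{s1..s2}|lborel. v s)"
    and eq: "AE s in lborel. s \<in> {0<..<T} \<longrightarrow> u s = u0 s"
    and u0p: "set_integrable lborel {0<..<T} (\<lambda>s. \<bar>u0 s\<bar> powr p)"
    and vp: "set_integrable lborel {0<..<T} (\<lambda>s. \<bar>v s\<bar> powr p)"
  shows "\<exists>l. (u \<longlongrightarrow> l) (at_right 0)
     \<and> T * \<bar>l\<bar> powr p \<le> 2 powr (p - 1) *
          ((LINT s:{0<..<T}|lborel. \<bar>u0 s\<bar> powr p) + (LINT s:{0<..<T}|lborel. \<bar>v s\<bar> powr p))
     \<and> T * l = (LINT t:{0<..<T}|lborel. u0 t - \<kappa> * (LINT s:{0<..t}|lborel. v s))"
proof -
  have v1: "set_integrable lborel {0<..<T} v"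
    by (rule jensen_powr_unit_interval(1)[OF p T _ vp]) simp
  have v1': "set_integrable lborel {0<..t} v" if "t < T" for t
    using that by (intro set_integrable_subset[OF v1]) auto
  define c where "c = T / 2"
  have c: "0 < c" "c < T" using T by (auto simp: c_def)
  define l where "l = u c - \<kappa> * (LINT s:{0<..c}|lborel. v s)"
  have "((\<lambda>a. LINT s:{a..c}|lborel. v s) \<longlongrightarrow> (LINT s:{0<..c}|lborel. v s)) (at_right 0)"
    by (intro tendsto_set_lebesgue_integral_at_right v1' c) auto
  then have "((\<lambda>a. u c - \<kappa> * (LINT s:{a..c}|lborel. v s)) \<longlongrightarrow> l) (at_right 0)"
    unfolding l_def by (intro tendsto_intros)
  moreover have "eventually (\<lambda>a. u c - \<kappa> * (LINT s:{a..c}|lborel. v s) = u a) (at_right 0)"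
    using eventually_at_right_less[of 0] eventually_at_right_real[OF c(1)]
    by eventually_elim (use incr[of _ c] c in force)
  ultimately have lim: "(u \<longlongrightarrow> l) (at_right 0)"
    by (rule Lim_transform_eventually)
  have u: "u t = l + \<kappa> * (LINT s:{0<..t}|lborel. v s)" if "0 < t" "t < T" for t
  proof -
    have "((\<lambda>a. LINT s:{a..t}|lborel. v s) \<longlongrightarrow> (LINT s:{0<..t}|lborel. v s)) (at_right 0)"
      using that by (intro tendsto_set_lebesgue_integral_at_right v1') auto
    then have "((\<lambda>a. u t - \<kappa> * (LINT s:{a..t}|lborel. v s)) \<longlongrightarrow>
        u t - \<kappa> * (LINT s:{0<..t}|lborel. v s)) (at_right 0)"
      by (intro tendsto_intros)
    moreover have "eventually (\<lambda>a. u t - \<kappa> * (LINT s:{a..t}|lborel. v s) = u a) (at_right 0)"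
      using eventually_at_right_less[of 0] eventually_at_right_real[OF that(1)]
      by eventually_elim (use incr[of _ t] that in force)
    ultimately have "(u \<longlongrightarrow> u t - \<kappa> * (LINT s:{0<..t}|lborel. v s)) (at_right 0)"
      by (rule Lim_transform_eventually)
    from tendsto_unique[OF _ lim this] show ?thesis by simp
  qed
  have constI: "(LINT s:{0<..<T}|lborel. k) = T * k" for k :: real
    using T by (simp add: set_lebesgue_integral_def)
  have const: "set_integrable lborel {0<..<T} (\<lambda>s. k)" for k :: real
    using T by (simp add: set_integrable_def)
  define V where "V = (LINT s:{0<..<T}|lborel. \<bar>v s\<bar> powr p)"
  have V0: "0 \<le> V" unfolding V_def set_lebesgue_integral_def by (intro Bochner_Integration.integral_nonneg) auto
  \<comment> \<open>The limit and the value at \<open>t\<close> differ by at most the total variation \<open>\<integral> |v|\<close>.\<close>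
  have bound: "\<bar>l\<bar> powr p \<le> 2 powr (p - 1) * (\<bar>u t\<bar> powr p + V)" if t: "0 < t" "t < T" for t
  proof -
    let ?W = "LINT s:{0<..<T}|lborel. \<bar>v s\<bar>"
    have "\<bar>LINT s:{0<..t}|lborel. v s\<bar> \<le> (LINT s:{0<..t}|lborel. \<bar>v s\<bar>)"
      unfolding set_lebesgue_integral_def
      by (rule order.trans[OF integral_abs_bound]) (auto simp: abs_mult)
    also have "\<dots> \<le> ?W"
      unfolding set_lebesgue_integral_def
      using set_integrable_abs[OF v1'[OF t(2)]] set_integrable_abs[OF v1] t
      by (intro integral_mono) (auto simp: set_integrable_def indicator_def)
    finally have "\<bar>l\<bar> \<le> \<bar>u t\<bar> + ?W"
      using u[OF t] \<kappa> abs_mult[of \<kappa> "LINT s:{0<..t}|lborel. v s"] by auto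
    moreover have W0: "0 \<le> ?W" unfolding set_lebesgue_integral_def by (intro Bochner_Integration.integral_nonneg) auto
    ultimately have "\<bar>l\<bar> powr p \<le> (\<bar>u t\<bar> + ?W) powr p"
      using p by (intro powr_mono2) auto
    also have "\<dots> \<le> 2 powr (p - 1) * (\<bar>u t\<bar> powr p + ?W powr p)"
      by (rule powr_add_le[OF p]) (use W0 in auto)
    also have "\<dots> \<le> 2 powr (p - 1) * (\<bar>u t\<bar> powr p + V)"
      using jensen_powr_unit_interval(2)[OF p T _ vp] by (intro mult_left_mono) (auto simp: V_def)
    finally show ?thesis .
  qed
  \<comment> \<open>The left-hand side of the bound is constant in \<open>t\<close>, so integrating over \<open>t\<close> multiplies it by \<open>T\<close>.\<close>
  have "T * \<bar>l\<bar> powr p = (LINT s:{0<..<T}|lborel. \<bar>l\<bar> powr p)" by (simp add: constI)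
  also have "\<dots> \<le> (LINT s:{0<..<T}|lborel. 2 powr (p - 1) * (\<bar>u0 s\<bar> powr p + V))"
  proof (rule set_integral_mono_AE)
    show "AE s in lborel. s \<in> {0<..<T} \<longrightarrow> \<bar>l\<bar> powr p \<le> 2 powr (p - 1) * (\<bar>u0 s\<bar> powr p + V)"
      using eq by eventually_elim (use bound in force)
  qed (intro const set_integrable_mult_right set_integral_add(1) u0p)+
  also have "\<dots> = 2 powr (p - 1) * ((LINT s:{0<..<T}|lborel. \<bar>u0 s\<bar> powr p) + T * V)"
    by (simp add: set_integral_add u0p const constI)
  also have "\<dots> \<le> 2 powr (p - 1) * ((LINT s:{0<..<T}|lborel. \<bar>u0 s\<bar> powr p) + V)"
    using T V0 mult_right_mono[of T 1 V] by (intro mult_left_mono) auto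
  finally have est: "T * \<bar>l\<bar> powr p \<le> \<dots>" .
  have meas: "(\<lambda>t. LINT s:{0<..t}|lborel. v s) \<in> borel_measurable borel"
    unfolding set_lebesgue_integral_def indicator_def greaterThanAtMost_iff
    by (rule sigma_finite_measure.borel_measurable_lebesgue_integral) (simp_all add: sigma_finite_lborel split_beta')
  have "T * l = (LINT t:{0<..<T}|lborel. l)" by (simp add: constI)
  also have "\<dots> = (LINT t:{0<..<T}|lborel. u0 t - \<kappa> * (LINT s:{0<..t}|lborel. v s))"
  proof (rule set_lebesgue_integral_cong_AE)
    show "AE t\<in>{0<..<T} in lborel. l = u0 t - \<kappa> * (LINT s:{0<..t}|lborel. v s)"
      using eq by eventually_elim (use u in force)
  qed (use meas in measurable)
  finally show ?thesis using lim est unfolding V_def by blast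
qed

section \<open>Borel versions of functions in Lebesgue spaces\<close>

text \<open>Membership and norm are taken in the completion, so they can be computed from any measurable
  function in the same almost-everywhere class.\<close>

lemma Lp_AE_eq:
  fixes f g :: "'a \<Rightarrow> real"
  assumes g [measurable]: "g \<in> borel_measurable M" and eq: "AE x in M. f x = g x"
  shows Lp_iff_of_AE_eq: "f \<in> Lp p M \<longleftrightarrow> integrable M (\<lambda>x. \<bar>g x\<bar> powr p)"
    and Lp_norm_of_AE_eq: "p \<noteq> 0 \<Longrightarrow> Lp_norm p M f powr p = (LINT x|M. \<bar>g x\<bar> powr p)"
proof -
  obtain N where N: "{x \<in> space M. f x \<noteq> g x} \<subseteq> N" "N \<in> null_sets M"
    using eq by (auto elim!: AE_E)
  have f [measurable]: "f \<in> borel_measurable (completion M)"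
  proof (rule measurableI)
    fix A :: "real set" assume A: "A \<in> sets borel"
    have [measurable]: "N \<in> sets M" using N by auto
    have dec: "f -` A \<inter> space M = (g -` A \<inter> space M - N) \<union> (f -` A \<inter> space M \<inter> N)"
      using N by auto
    have "g -` A \<inter> space M - N \<in> sets M" using A by measurable
    then show "f -` A \<inter> space (completion M) \<in> sets (completion M)"
      unfolding space_completion by (intro sets_completionI[OF dec _ N(2)]) auto
  qed simp
  have [measurable]: "g \<in> borel_measurable (completion M)" by (intro measurable_completion g)
  have ae: "AE x in completion M. \<bar>f x\<bar> powr p = \<bar>g x\<bar> powr p"
    using AE_completion[OF eq] by eventually_elim simp
  have "integrable (completion M) (\<lambda>x. \<bar>f x\<bar> powr p) \<longleftrightarrow> integrable (completion M) (\<lambda>x. \<bar>g x\<bar> powr p)"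
    by (intro integrable_cong_AE ae) simp_all
  also have "\<dots> \<longleftrightarrow> integrable M (\<lambda>x. \<bar>g x\<bar> powr p)"
    by (rule integrable_completion) simp
  finally show "f \<in> Lp p M \<longleftrightarrow> integrable M (\<lambda>x. \<bar>g x\<bar> powr p)"
    by (simp add: Lp_def f)
  have "(LINT x|completion M. \<bar>f x\<bar> powr p) = (LINT x|completion M. \<bar>g x\<bar> powr p)"
    by (intro integral_cong_AE ae) simp_all
  also have "\<dots> = (LINT x|M. \<bar>g x\<bar> powr p)"
    by (rule integral_completion) simp
  finally have I: "(LINT x|completion M. \<bar>f x\<bar> powr p) = (LINT x|M. \<bar>g x\<bar> powr p)" .
  have "0 \<le> (LINT x|M. \<bar>g x\<bar> powr p)" by (intro Bochner_Integration.integral_nonneg) simp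
  then show "p \<noteq> 0 \<Longrightarrow> Lp_norm p M f powr p = (LINT x|M. \<bar>g x\<bar> powr p)"
    unfolding Lp_norm_def I by (simp add: powr_powr)
qed

lemma Lp_restrict_space_borel_version:
  fixes f :: "'a::euclidean_space \<Rightarrow> real"
  assumes \<mu>: "sets \<mu> = sets borel" and \<Omega>: "\<Omega> \<in> sets borel" and p: "p \<noteq> 0"
    and f: "f \<in> Lp p (restrict_space \<mu> \<Omega>)"
  obtains f0 where "f0 \<in> borel_measurable borel" "AE x in restrict_space \<mu> \<Omega>. f x = f0 x"
    "set_integrable \<mu> \<Omega> (\<lambda>x. \<bar>f0 x\<bar> powr p)"
    "(LINT x:\<Omega>|\<mu>. \<bar>f0 x\<bar> powr p) = Lp_norm p (restrict_space \<mu> \<Omega>) f powr p"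
proof -
  have \<Omega>\<mu>: "\<Omega> \<inter> space \<mu> \<in> sets \<mu>"
    using \<Omega> \<mu> sets_eq_imp_space_eq[OF \<mu>] by simp
  have "f \<in> borel_measurable (completion (restrict_space \<mu> \<Omega>))"
    using f by (simp add: Lp_def)
  then obtain f1 where f1: "f1 \<in> borel_measurable (restrict_space \<mu> \<Omega>)"
      "AE x in restrict_space \<mu> \<Omega>. f x = f1 x"
    using completion_ex_borel_measurable_real by blast
  define f0 where "f0 = (\<lambda>x. indicator \<Omega> x *\<^sub>R f1 x)"
  have "f0 \<in> borel_measurable \<mu>"
    using f1(1) unfolding f0_def by (simp add: borel_measurable_restrict_space_iff[OF \<Omega>\<mu>])
  then have f0: "f0 \<in> borel_measurable borel"
    using measurable_cong_sets[OF \<mu> refl] by blast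
  have eq: "AE x in restrict_space \<mu> \<Omega>. f x = f0 x"
    using f1(2) AE_space by eventually_elim (simp add: f0_def space_restrict_space)
  have f0': "f0 \<in> borel_measurable (restrict_space \<mu> \<Omega>)"
    using \<open>f0 \<in> borel_measurable \<mu>\<close> by (rule measurable_restrict_space1)
  show thesis
  proof (rule that[OF f0 eq])
    show "set_integrable \<mu> \<Omega> (\<lambda>x. \<bar>f0 x\<bar> powr p)"
      using f unfolding Lp_iff_of_AE_eq[OF f0' eq] integrable_restrict_space[OF \<Omega>\<mu>]
        set_integrable_def .
    show "(LINT x:\<Omega>|\<mu>. \<bar>f0 x\<bar> powr p) = Lp_norm p (restrict_space \<mu> \<Omega>) f powr p"
      unfolding Lp_norm_of_AE_eq[OF f0' eq p] integral_restrict_space[OF \<Omega>\<mu>]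
        set_lebesgue_integral_def ..
  qed
qed

section \<open>Integration along trajectories\<close>

lemma boundary_measureD:
  fixes h :: "'a::euclidean_space \<Rightarrow> real"
  assumes "boundary_measure \<mu> \<Phi> \<Omega> \<sigma> \<nu>" and "set_integrable \<mu> \<Omega> h"
  shows "AE y in \<nu>. set_integrable lborel {s. 0 < s \<and> ereal s < exit_time \<Phi> \<Omega> (- \<sigma>) y}
            (\<lambda>s. h (\<Phi> y (- \<sigma> * s)))"
    and "integrable \<nu> (\<lambda>y. LINT s:{s. 0 < s \<and> ereal s < exit_time \<Phi> \<Omega> (- \<sigma>) y}|lborel.
            h (\<Phi> y (- \<sigma> * s)))"
    and "(LINT x:Omega_fin \<Phi> \<Omega> \<sigma>|\<mu>. h x) =
          (LINT y|\<nu>. (LINT s:{s. 0 < s \<and> ereal s < exit_time \<Phi> \<Omega> (- \<sigma>) y}|lborel.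
            h (\<Phi> y (- \<sigma> * s))))"
  using assms unfolding boundary_measure_def by blast+

text \<open>The left-hand side is the integral over \<open>\<Omega>\<^sub>\<sigma>\<close>, a part of \<open>\<Omega>\<close>.\<close>

lemma boundary_measure_slice_integral_le:
  fixes h :: "'a::euclidean_space \<Rightarrow> real"
  assumes bm: "boundary_measure \<mu> \<Phi> \<Omega> \<sigma> \<nu>" and h: "set_integrable \<mu> \<Omega> h" "\<And>x. 0 \<le> h x"
  shows "(LINT y|\<nu>. (LINT s:{s. 0 < s \<and> ereal s < exit_time \<Phi> \<Omega> (- \<sigma>) y}|lborel.
            h (\<Phi> y (- \<sigma> * s)))) \<le> (LINT x:\<Omega>|\<mu>. h x)"
proof -
  have 0: "0 \<le> (LINT x:\<Omega>|\<mu>. h x)"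
    unfolding set_lebesgue_integral_def using h(2) by (intro Bochner_Integration.integral_nonneg) simp
  have "(LINT x:Omega_fin \<Phi> \<Omega> \<sigma>|\<mu>. h x) \<le> (LINT x:\<Omega>|\<mu>. h x)"
  \<comment> \<open>A set integral that does not exist is \<open>0\<close> by convention, which is below the right-hand side.\<close>
  proof (cases "set_integrable \<mu> (Omega_fin \<Phi> \<Omega> \<sigma>) h")
    case True
    then show ?thesis
      using h unfolding set_lebesgue_integral_def set_integrable_def
      by (intro integral_mono) (auto simp: indicator_def Omega_fin_def)
  next
    case False
    then show ?thesis using 0
      by (simp add: set_lebesgue_integral_def set_integrable_def not_integrable_integral_eq)
  qed
  then show ?thesis using boundary_measureD(3)[OF bm h(1)] by simp
qed

text \<open>Apply the defining property of \<open>\<nu>\<close> to the indicator of the exceptional null set: its integral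
  vanishes, hence so does its integral along almost every trajectory.\<close>

lemma boundary_measure_AE_slices:
  fixes \<mu> :: "'a::euclidean_space measure"
  assumes \<mu>: "sets \<mu> = sets borel" and \<Omega>: "\<Omega> \<in> sets borel"
    and bm: "boundary_measure \<mu> \<Phi> \<Omega> \<sigma> \<nu>"
    and P: "AE x in restrict_space \<mu> \<Omega>. P x"
  shows "AE y in \<nu>. AE s in lborel. 0 < s \<and> ereal s < exit_time \<Phi> \<Omega> (- \<sigma>) y \<and> \<Phi> y (- \<sigma> * s) \<in> \<Omega>
            \<longrightarrow> P (\<Phi> y (- \<sigma> * s))"
proof -
  have sp: "space \<mu> = UNIV" using sets_eq_imp_space_eq[OF \<mu>] by simp
  have "AE x in \<mu>. x \<in> \<Omega> \<longrightarrow> P x"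
    using P \<mu> \<Omega> by (subst (asm) AE_restrict_space_iff) (auto simp: sp)
  then obtain N where N: "{x. \<not> (x \<in> \<Omega> \<longrightarrow> P x)} \<subseteq> N" "N \<in> null_sets \<mu>"
    by (rule AE_E) (auto simp: sp null_sets_def)
  define D where "D y = {s. 0 < s \<and> ereal s < exit_time \<Phi> \<Omega> (- \<sigma>) y}" for y
  have ae0: "AE x in \<mu>. indicator A x *\<^sub>R indicat_real N x = 0" for A
    using AE_not_in[OF N(2)] by eventually_elim simp
  have h: "set_integrable \<mu> \<Omega> (indicat_real N)"
    unfolding set_integrable_def
    using N(2) \<Omega> \<mu> ae0 by (subst integrable_cong_AE[where g = "\<lambda>_. 0"]) auto
  note bmN = boundary_measureD[OF bm h, folded D_def]
  have "(LINT y|\<nu>. (LINT s:D y|lborel. indicat_real N (\<Phi> y (- \<sigma> * s)))) = 0"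
    unfolding bmN(3)[symmetric] unfolding set_lebesgue_integral_def by (rule integral_eq_zero_AE[OF ae0])
  then have "AE y in \<nu>. (LINT s:D y|lborel. indicat_real N (\<Phi> y (- \<sigma> * s))) = 0"
    by (subst (asm) integral_nonneg_eq_0_iff_AE[OF bmN(2)])
       (auto simp: set_lebesgue_integral_def intro!: Bochner_Integration.integral_nonneg)
  with bmN(1) show ?thesis
  proof eventually_elim
    case (elim y)
    then have "AE s in lborel. indicator (D y) s *\<^sub>R indicat_real N (\<Phi> y (- \<sigma> * s)) = 0"
      unfolding set_lebesgue_integral_def set_integrable_def
      by (subst (asm) integral_nonneg_eq_0_iff_AE) auto
    then show ?case
      by eventually_elim (use N(1) in \<open>auto simp: D_def indicator_def split: if_splits\<close>)
  qed
qed

context lipschitz_flow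
begin

text \<open>The increment formula is known along trajectories started at a point \<open>x = \<Phi>(y, -\<sigma>s0)\<close> inside \<open>\<Omega>\<close>.
  Since the trajectory of \<open>x\<close> reaches from \<open>y\<close> up to the exit on the other side, it can be rewritten in the
  time \<open>s\<close> that is counted from the boundary point \<open>y\<close> into \<open>\<Omega>\<close>. The two times are related by the affine
  substitution \<open>r = \<sigma>(s0 - s)\<close>, which reverses orientation exactly if \<open>\<sigma> = 1\<close>; this is where the
  factor \<open>\<sigma>\<close> on the right comes from.\<close>

lemma increment_from_boundary_point:
  fixes fs g g0 :: "'a \<Rightarrow> real" and y :: 'a and \<Omega> :: "'a set" and \<sigma> :: real
  defines "\<tau> \<equiv> exit_time \<Phi> \<Omega> (- \<sigma>) y"
  assumes \<sigma>: "\<sigma> \<in> {1, - 1}"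
    and s0: "0 < s0" "ereal s0 < \<tau>"
    and sharp: "\<forall>t1 t2. - exit_time \<Phi> \<Omega> (- 1) (\<Phi> y (- \<sigma> * s0)) < ereal t1 \<and> t1 \<le> t2 \<and>
          ereal t2 < exit_time \<Phi> \<Omega> 1 (\<Phi> y (- \<sigma> * s0)) \<longrightarrow>
          set_integrable lebesgue {t1..t2} (\<lambda>s. g (\<Phi> (\<Phi> y (- \<sigma> * s0)) s)) \<and>
          fs (\<Phi> (\<Phi> y (- \<sigma> * s0)) t1) - fs (\<Phi> (\<Phi> y (- \<sigma> * s0)) t2)
            = (LINT s:{t1..t2}|lebesgue. g (\<Phi> (\<Phi> y (- \<sigma> * s0)) s))"
    and [measurable]: "g0 \<in> borel_measurable borel"
    and eq: "AE s in lborel. 0 < s \<and> ereal s < \<tau> \<longrightarrow> g (\<Phi> y (- \<sigma> * s)) = g0 (\<Phi> y (- \<sigma> * s))"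
    and s: "0 < s1" "s1 \<le> s2" "ereal s2 < \<tau>"
  shows "fs (\<Phi> y (- \<sigma> * s2)) - fs (\<Phi> y (- \<sigma> * s1))
           = \<sigma> * (LINT s:{s1..s2}|lborel. g0 (\<Phi> y (- \<sigma> * s)))"
proof -
  define x where "x = \<Phi> y (- \<sigma> * s0)"
  have x: "\<Phi> x (\<sigma> * r) = \<Phi> y (- \<sigma> * (s0 - r))" for r
    by (simp add: x_def flow_add algebra_simps)
  have fwd: "ereal s0 \<le> exit_time \<Phi> \<Omega> \<sigma> x"
  proof (rule exit_time_geI)
    fix r assume r: "0 < r" "ereal r < ereal s0"
    then have "ereal (s0 - r) < \<tau>" using s0(2) by (cases \<tau>) auto
    then show "\<Phi> x (\<sigma> * r) \<in> \<Omega>"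
      unfolding x using r by (intro flow_inside) (auto simp: \<tau>_def)
  qed
  have bwd: "\<tau> - ereal s0 \<le> exit_time \<Phi> \<Omega> (- \<sigma>) x"
  proof (rule exit_time_geI)
    fix r assume r: "0 < r" "ereal r < \<tau> - ereal s0"
    have "ereal (s0 + r) < \<tau>" using r(2) by (cases \<tau>) auto
    moreover have "\<Phi> x (- \<sigma> * r) = \<Phi> y (- \<sigma> * (s0 + r))"
      using x[of "- r"] by (simp add: algebra_simps)
    ultimately show "\<Phi> x (- \<sigma> * r) \<in> \<Omega>"
      using flow_inside[of "s0 + r" \<Omega> "- \<sigma>" y] r(1) s0(1) by (auto simp: \<tau>_def)
  qed
  have fwd': "ereal (s0 - s1) < exit_time \<Phi> \<Omega> \<sigma> x"
    by (rule less_le_trans[OF _ fwd]) (use s in simp)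
  have bwd': "ereal (s2 - s0) < exit_time \<Phi> \<Omega> (- \<sigma>) x"
    by (rule less_le_trans[OF _ bwd]) (use s in \<open>cases \<tau>; simp\<close>)
  \<comment> \<open>The image of \<open>[s1, s2]\<close> under the substitution.\<close>
  define A where "A = (if \<sigma> = 1 then {s0 - s2..s0 - s1} else {s1 - s0..s2 - s0})"
  have A: "indicator A (\<sigma> * s0 + (- \<sigma>) * r) = indicat_real {s1..s2} r" for r
    using \<sigma> by (auto simp: A_def indicator_def)
  have x': "\<Phi> x (\<sigma> * s0 + (- \<sigma>) * r) = \<Phi> y (- \<sigma> * r)" for r
    using x[of "s0 - r"] by (simp add: algebra_simps)
  have "set_integrable lebesgue A (\<lambda>s. g (\<Phi> x s)) \<and>
      fs (\<Phi> y (- \<sigma> * s2)) - fs (\<Phi> y (- \<sigma> * s1)) = \<sigma> * (LINT s:A|lebesgue. g (\<Phi> x s))"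
  proof (cases "\<sigma> = 1")
    case True
    have "- exit_time \<Phi> \<Omega> (- 1) x < ereal (s0 - s2)"
      using bwd' True by (cases "exit_time \<Phi> \<Omega> (- 1) x") auto
    with fwd' True s sharp[folded x_def, rule_format, of "s0 - s2" "s0 - s1"] x[of "s0 - s2"] x[of "s0 - s1"]
    show ?thesis by (simp add: A_def)
  next
    case False
    then have m: "\<sigma> = - 1" using \<sigma> by auto
    have "- exit_time \<Phi> \<Omega> (- 1) x < ereal (s1 - s0)"
      using fwd' m by (cases "exit_time \<Phi> \<Omega> (- 1) x") auto
    with bwd' m s sharp[folded x_def, rule_format, of "s1 - s0" "s2 - s0"] x[of "s0 - s2"] x[of "s0 - s1"]
    show ?thesis by (simp add: A_def)
  qed
  then have int: "integrable lebesgue (\<lambda>s. indicator A s *\<^sub>R g (\<Phi> x s))"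
    and incr: "fs (\<Phi> y (- \<sigma> * s2)) - fs (\<Phi> y (- \<sigma> * s1))
        = \<sigma> * (\<integral>s. indicator A s *\<^sub>R g (\<Phi> x s) \<partial>lebesgue)"
    by (auto simp: set_integrable_def set_lebesgue_integral_def)
  have \<sigma>0: "- \<sigma> \<noteq> 0" and \<sigma>1: "\<bar>- \<sigma>\<bar> = 1" using \<sigma> by auto
  have int': "integrable lebesgue (\<lambda>r. indicator {s1..s2} r *\<^sub>R g (\<Phi> y (- \<sigma> * r)))"
    using int lebesgue_integrable_real_affine_iff[OF \<sigma>0, of "\<lambda>s. indicator A s *\<^sub>R g (\<Phi> x s)" "\<sigma> * s0"]
    unfolding A x' by simp
  have "(\<integral>s. indicator A s *\<^sub>R g (\<Phi> x s) \<partial>lebesgue)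
      = (\<integral>r. indicator {s1..s2} r *\<^sub>R g (\<Phi> y (- \<sigma> * r)) \<partial>lebesgue)"
    using lebesgue_integral_real_affine[OF \<sigma>0, of "\<lambda>s. indicator A s *\<^sub>R g (\<Phi> x s)" "\<sigma> * s0"]
    unfolding A x' \<sigma>1 by simp
  \<comment> \<open>The Borel version \<open>g0\<close> allows the change from Lebesgue to Borel measurable integrands.\<close>
  also have "\<dots> = (\<integral>r. indicator {s1..s2} r *\<^sub>R g0 (\<Phi> y (- \<sigma> * r)) \<partial>lebesgue)"
  proof (rule integral_cong_AE)
    show "(\<lambda>r. indicator {s1..s2} r *\<^sub>R g (\<Phi> y (- \<sigma> * r))) \<in> borel_measurable lebesgue"
      using int' by auto
    show "(\<lambda>r. indicator {s1..s2} r *\<^sub>R g0 (\<Phi> y (- \<sigma> * r))) \<in> borel_measurable lebesgue"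
      by (intro measurable_completion) measurable
    show "AE r in lebesgue. indicat_real {s1..s2} r *\<^sub>R g (\<Phi> y (- \<sigma> * r))
        = indicat_real {s1..s2} r *\<^sub>R g0 (\<Phi> y (- \<sigma> * r))"
      using AE_completion[OF eq]
    proof eventually_elim
      case (elim r)
      have "ereal r < \<tau>" if "r \<le> s2"
        using that s(3) by (meson ereal_less_eq(3) le_less_trans)
      then show ?case using elim s(1) by (auto simp: indicator_def)
    qed
  qed
  also have "\<dots> = (LINT s:{s1..s2}|lborel. g0 (\<Phi> y (- \<sigma> * s)))"
    unfolding set_lebesgue_integral_def by (rule integral_completion) measurable
  finally show ?thesis using incr by simp
qed

text \<open>The increment formula is available from almost every point of the slice; one such point is enough,
  since all points of the slice lie on one trajectory. The bound on \<open>T\<close> by \<open>1\<close> in \<open>endpoint_trace\<close> is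
  the reason for the truncation in the weight of \<open>\<xi>\<^sub>\<sigma>\<close>.\<close>

lemma trace_on_slice:
  fixes fs f0 g g0 :: "'a \<Rightarrow> real" and y :: 'a and \<Omega> :: "'a set" and \<sigma> :: real
  defines "\<tau> \<equiv> exit_time \<Phi> \<Omega> (- \<sigma>) y"
  defines "D \<equiv> {s. 0 < s \<and> ereal s < \<tau>}"
  defines "T \<equiv> real_of_ereal (min \<tau> 1)"
  assumes \<sigma>: "\<sigma> \<in> {1, - 1}" and p: "1 < p" and \<tau>: "0 < \<tau>"
    and [measurable]: "f0 \<in> borel_measurable borel" "g0 \<in> borel_measurable borel"
    and fs: "AE s in lborel. s \<in> D \<longrightarrow> fs (\<Phi> y (- \<sigma> * s)) = f0 (\<Phi> y (- \<sigma> * s))"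
    and g: "AE s in lborel. s \<in> D \<longrightarrow> g (\<Phi> y (- \<sigma> * s)) = g0 (\<Phi> y (- \<sigma> * s))"
    and sharp: "AE s0 in lborel. s0 \<in> D \<longrightarrow> (\<forall>t1 t2.
          - exit_time \<Phi> \<Omega> (- 1) (\<Phi> y (- \<sigma> * s0)) < ereal t1 \<and> t1 \<le> t2 \<and>
          ereal t2 < exit_time \<Phi> \<Omega> 1 (\<Phi> y (- \<sigma> * s0)) \<longrightarrow>
          set_integrable lebesgue {t1..t2} (\<lambda>s. g (\<Phi> (\<Phi> y (- \<sigma> * s0)) s)) \<and>
          fs (\<Phi> (\<Phi> y (- \<sigma> * s0)) t1) - fs (\<Phi> (\<Phi> y (- \<sigma> * s0)) t2)
            = (LINT s:{t1..t2}|lebesgue. g (\<Phi> (\<Phi> y (- \<sigma> * s0)) s)))"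
    and f0p: "set_integrable lborel D (\<lambda>s. \<bar>f0 (\<Phi> y (- \<sigma> * s))\<bar> powr p)"
    and g0p: "set_integrable lborel D (\<lambda>s. \<bar>g0 (\<Phi> y (- \<sigma> * s))\<bar> powr p)"
  shows "trace_exists \<Phi> \<sigma> fs y"
    and "T * \<bar>flow_trace \<Phi> \<sigma> fs y\<bar> powr p \<le> 2 powr (p - 1) *
          ((LINT s:D|lborel. \<bar>f0 (\<Phi> y (- \<sigma> * s))\<bar> powr p)
            + (LINT s:D|lborel. \<bar>g0 (\<Phi> y (- \<sigma> * s))\<bar> powr p))"
    and "flow_trace \<Phi> \<sigma> fs y = (LINT t:{0<..<T}|lborel. f0 (\<Phi> y (- \<sigma> * t))
            - \<sigma> * (LINT s:{0<..t}|lborel. g0 (\<Phi> y (- \<sigma> * s)))) / T"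
proof -
  have T: "0 < T" "T \<le> 1" "ereal T \<le> \<tau>"
    using \<tau> unfolding T_def by (cases \<tau>; simp add: min_def)+
  have TD: "{0<..<T} \<subseteq> D"
    using T(3) unfolding D_def by (auto intro: less_le_trans[of _ "ereal T"])
  have "\<not> (AE s in lborel. s \<notin> {0<..<T})"
    using T(1) AE_iff_null_sets[of "{0<..<T}" lborel] by (auto simp: null_sets_def)
  have "\<exists>s0\<in>D. \<forall>t1 t2.
          - exit_time \<Phi> \<Omega> (- 1) (\<Phi> y (- \<sigma> * s0)) < ereal t1 \<and> t1 \<le> t2 \<and>
          ereal t2 < exit_time \<Phi> \<Omega> 1 (\<Phi> y (- \<sigma> * s0)) \<longrightarrow>
          set_integrable lebesgue {t1..t2} (\<lambda>s. g (\<Phi> (\<Phi> y (- \<sigma> * s0)) s)) \<and>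
          fs (\<Phi> (\<Phi> y (- \<sigma> * s0)) t1) - fs (\<Phi> (\<Phi> y (- \<sigma> * s0)) t2)
            = (LINT s:{t1..t2}|lebesgue. g (\<Phi> (\<Phi> y (- \<sigma> * s0)) s))"
    (is "\<exists>s0\<in>D. ?sharp s0")
  proof (rule ccontr)
    assume "\<not> (\<exists>s0\<in>D. ?sharp s0)"
    then have none: "\<not> ?sharp s0" if "s0 \<in> D" for s0 using that by blast
    have "AE s in lborel. s \<notin> {0<..<T}"
      using sharp by eventually_elim (use TD none in blast)
    then show False using \<open>\<not> (AE s in lborel. s \<notin> {0<..<T})\<close> by blast
  qed
  then obtain s0 where s0: "0 < s0" "ereal s0 < \<tau>" and sharp0: "?sharp s0"
    unfolding D_def by blast
  have incr: "fs (\<Phi> y (- \<sigma> * s2)) - fs (\<Phi> y (- \<sigma> * s1))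
           = \<sigma> * (LINT s:{s1..s2}|lborel. g0 (\<Phi> y (- \<sigma> * s)))"
    if "0 < s1" "s1 \<le> s2" "s2 < T" for s1 s2
  proof -
    have "s2 \<in> {0<..<T}" using that by simp
    then have "ereal s2 < exit_time \<Phi> \<Omega> (- \<sigma>) y"
      using TD by (auto simp only: D_def \<tau>_def mem_Collect_eq)
    then show ?thesis
      using increment_from_boundary_point[OF \<sigma> s0[unfolded \<tau>_def] sharp0 _
          g[unfolded D_def mem_Collect_eq \<tau>_def] that(1,2)]
      by simp
  qed
  have sub: "set_integrable lborel {0<..<T} h" "(LINT s:{0<..<T}|lborel. h s) \<le> (LINT s:D|lborel. h s)"
    if h: "set_integrable lborel D h" "\<And>s. 0 \<le> h s" for h :: "real \<Rightarrow> real"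
  proof -
    show *: "set_integrable lborel {0<..<T} h"
      by (rule set_integrable_subset[OF h(1) _ TD]) simp
    show "(LINT s:{0<..<T}|lborel. h s) \<le> (LINT s:D|lborel. h s)"
      using * h TD unfolding set_lebesgue_integral_def set_integrable_def
      by (intro integral_mono) (auto simp: indicator_def)
  qed
  have fsT: "AE s in lborel. s \<in> {0<..<T} \<longrightarrow> fs (\<Phi> y (- \<sigma> * s)) = f0 (\<Phi> y (- \<sigma> * s))"
    using fs by eventually_elim (use TD in blast)
  have \<sigma>1: "\<bar>\<sigma>\<bar> = 1" using \<sigma> by auto
  have [measurable]: "(\<lambda>s. f0 (\<Phi> y (- \<sigma> * s))) \<in> borel_measurable borel"
    "(\<lambda>s. g0 (\<Phi> y (- \<sigma> * s))) \<in> borel_measurable borel" by measurable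
  obtain l where l: "((\<lambda>s. fs (\<Phi> y (- \<sigma> * s))) \<longlongrightarrow> l) (at_right 0)"
     "T * \<bar>l\<bar> powr p \<le> 2 powr (p - 1) *
          ((LINT s:{0<..<T}|lborel. \<bar>f0 (\<Phi> y (- \<sigma> * s))\<bar> powr p)
            + (LINT s:{0<..<T}|lborel. \<bar>g0 (\<Phi> y (- \<sigma> * s))\<bar> powr p))"
     "T * l = (LINT t:{0<..<T}|lborel. f0 (\<Phi> y (- \<sigma> * t))
            - \<sigma> * (LINT s:{0<..t}|lborel. g0 (\<Phi> y (- \<sigma> * s))))"
    using endpoint_trace[OF p T(1,2) \<sigma>1 _ _ incr fsT sub(1)[OF f0p] sub(1)[OF g0p]] by auto
  have tr: "flow_trace \<Phi> \<sigma> fs y = l"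
    unfolding flow_trace_def by (rule tendsto_Lim[OF _ l(1)]) simp
  show "trace_exists \<Phi> \<sigma> fs y" unfolding trace_exists_def using l(1) by blast
  show "T * \<bar>flow_trace \<Phi> \<sigma> fs y\<bar> powr p \<le> 2 powr (p - 1) *
          ((LINT s:D|lborel. \<bar>f0 (\<Phi> y (- \<sigma> * s))\<bar> powr p)
            + (LINT s:D|lborel. \<bar>g0 (\<Phi> y (- \<sigma> * s))\<bar> powr p))"
    unfolding tr by (rule order.trans[OF l(2)]) (intro mult_left_mono add_mono sub(2) f0p g0p; simp)
  show "flow_trace \<Phi> \<sigma> fs y = (LINT t:{0<..<T}|lborel. f0 (\<Phi> y (- \<sigma> * t))
            - \<sigma> * (LINT s:{0<..t}|lborel. g0 (\<Phi> y (- \<sigma> * s)))) / T"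
    unfolding tr using l(3) T(1) by (simp add: field_simps)
qed

text \<open>With \<open>T\<close> the truncated exit time, \<open>trace_on_slice\<close> identifies this function with the trace for
  almost every \<open>y\<close>. It is measurable as an iterated integral of jointly Borel functions.\<close>

lemma slice_average_measurable:
  fixes f0 g0 :: "'a \<Rightarrow> real" and T :: "'a \<Rightarrow> real"
  assumes [measurable]: "f0 \<in> borel_measurable borel" "g0 \<in> borel_measurable borel"
    "T \<in> borel_measurable borel"
  shows "(\<lambda>y. (LINT t:{0<..<T y}|lborel. f0 (\<Phi> y (- \<sigma> * t))
            - \<sigma> * (LINT s:{0<..t}|lborel. g0 (\<Phi> y (- \<sigma> * s)))) / T y) \<in> borel_measurable borel"
proof -
  have [measurable]: "(\<lambda>z. LINT s:{0<..snd z}|lborel. g0 (\<Phi> (fst z) (- \<sigma> * s)))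
      \<in> borel_measurable (borel \<Otimes>\<^sub>M lborel)"
    unfolding set_lebesgue_integral_def indicator_def greaterThanAtMost_iff
    by (rule sigma_finite_measure.borel_measurable_lebesgue_integral)
       (simp_all add: sigma_finite_lborel split_beta')
  have "(\<lambda>y. LINT t:{0<..<T y}|lborel. f0 (\<Phi> y (- \<sigma> * t))
            - \<sigma> * (LINT s:{0<..t}|lborel. g0 (\<Phi> y (- \<sigma> * s)))) \<in> borel_measurable borel"
    unfolding set_lebesgue_integral_def[of _ "{0<..<_}"] indicator_def greaterThanLessThan_iff
    by (rule sigma_finite_measure.borel_measurable_lebesgue_integral[OF sigma_finite_lborel],
        unfold split_beta', measurable)
  then show ?thesis by simp
qed

end

section \<open>The trace theorem\<close>

theorem theorem3p3:
  fixes \<mu> :: "(real ^ 'n) measure"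
    and \<Omega> :: "(real ^ 'n) set"
    and F :: "real ^ 'n \<Rightarrow> real ^ 'n"
    and \<Phi> :: "real ^ 'n \<Rightarrow> real \<Rightarrow> real ^ 'n"
    and \<sigma> p :: real
    and \<nu> :: "(real ^ 'n) measure"
    and f fs :: "real ^ 'n \<Rightarrow> real"
  assumes "radon_measure \<mu>"
    and "open \<Omega>"
    and "\<exists>L. L-lipschitz_on UNIV F"
    and "is_flow F \<Phi>"
    and "flow_preserves \<mu> \<Phi>"
    and "\<sigma> \<in> {1, - 1}"
    and "boundary_measure \<mu> \<Phi> \<Omega> \<sigma> \<nu>"
    and "1 < p"
    and "f \<in> Tmax_dom \<mu> \<Phi> \<Omega> p"
    and "sharp_rep \<mu> \<Phi> \<Omega> p f fs"
  shows "(AE y in \<nu>. trace_exists \<Phi> \<sigma> fs y) \<and>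
         flow_trace \<Phi> \<sigma> fs \<in> Lp p (xi \<Phi> \<Omega> \<sigma> \<nu>) \<and>
         Lp_norm p (xi \<Phi> \<Omega> \<sigma> \<nu>) (flow_trace \<Phi> \<sigma> fs) powr p
           \<le> 2 powr (p - 1) * (Lp_norm p (restrict_space \<mu> \<Omega>) f powr p
                               + Lp_norm p (restrict_space \<mu> \<Omega>) (Tmax \<mu> \<Phi> \<Omega> p f) powr p)"
proof -
  obtain L where "L-lipschitz_on UNIV F" using assms(3) by blast
  then interpret lipschitz_flow F \<Phi> L using assms(4) by unfold_locales
  note \<Omega> = \<open>open \<Omega>\<close> and \<sigma> = \<open>\<sigma> \<in> {1, - 1}\<close> and bm = \<open>boundary_measure \<mu> \<Phi> \<Omega> \<sigma> \<nu>\<close> and p = \<open>1 < p\<close>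
  have \<mu>: "sets \<mu> = sets borel" using assms(1) by (simp add: radon_measure_def)
  have \<Omega>b: "\<Omega> \<in> sets borel" and p0: "p \<noteq> 0" using \<Omega> p by auto
  define g where "g = Tmax \<mu> \<Phi> \<Omega> p f"
  have "weak_transport \<mu> \<Phi> \<Omega> p f g"
    using assms(9) someI_ex[of "weak_transport \<mu> \<Phi> \<Omega> p f"]
    unfolding g_def Tmax_def Tmax_dom_def by blast
  then have gLp: "g \<in> Lp p (restrict_space \<mu> \<Omega>)" by (simp add: weak_transport_def)
  have fLp: "f \<in> Lp p (restrict_space \<mu> \<Omega>)" using assms(9) by (simp add: Tmax_dom_def)
  obtain f0 where f0 [measurable]: "f0 \<in> borel_measurable borel"
      and f_f0: "AE x in restrict_space \<mu> \<Omega>. f x = f0 x"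
      and f0p: "set_integrable \<mu> \<Omega> (\<lambda>x. \<bar>f0 x\<bar> powr p)"
      and f0n: "(LINT x:\<Omega>|\<mu>. \<bar>f0 x\<bar> powr p) = Lp_norm p (restrict_space \<mu> \<Omega>) f powr p"
    using Lp_restrict_space_borel_version[OF \<mu> \<Omega>b p0 fLp] by blast
  obtain g0 where g0 [measurable]: "g0 \<in> borel_measurable borel"
      and g_g0: "AE x in restrict_space \<mu> \<Omega>. g x = g0 x"
      and g0p: "set_integrable \<mu> \<Omega> (\<lambda>x. \<bar>g0 x\<bar> powr p)"
      and g0n: "(LINT x:\<Omega>|\<mu>. \<bar>g0 x\<bar> powr p) = Lp_norm p (restrict_space \<mu> \<Omega>) g powr p"
    using Lp_restrict_space_borel_version[OF \<mu> \<Omega>b p0 gLp] by blast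
  define D where "D y = {s. 0 < s \<and> ereal s < exit_time \<Phi> \<Omega> (- \<sigma>) y}" for y
  define T where "T y = real_of_ereal (min (exit_time \<Phi> \<Omega> (- \<sigma>) y) 1)" for y
  \<comment> \<open>\<open>B\<close> is a Borel version of the trace, and
     \<open>I h y\<close> is the \<open>p\<close>-th power integral of \<open>h\<close> over the slice of \<open>y\<close>.\<close>
  define B where "B y = (LINT t:{0<..<T y}|lborel. f0 (\<Phi> y (- \<sigma> * t))
            - \<sigma> * (LINT s:{0<..t}|lborel. g0 (\<Phi> y (- \<sigma> * s)))) / T y" for y
  define I where "I = (\<lambda>h y. LINT s:D y|lborel. \<bar>h (\<Phi> y (- \<sigma> * s))\<bar> powr p)"
  have slices: "AE y in \<nu>. AE s in lborel. s \<in> D y \<longrightarrow> P (\<Phi> y (- \<sigma> * s))"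
    if P: "AE x in restrict_space \<mu> \<Omega>. P x" for P
    using boundary_measure_AE_slices[OF \<mu> \<Omega>b bm P]
    by eventually_elim (erule eventually_mono, use flow_inside in \<open>fastforce simp: D_def\<close>)
  have fs_f0: "AE x in restrict_space \<mu> \<Omega>. fs x = f0 x"
    using assms(10) f_f0 unfolding sharp_rep_def by (auto elim: eventually_elim2)
  have sharp: "AE x in restrict_space \<mu> \<Omega>. \<forall>t1 t2.
        - exit_time \<Phi> \<Omega> (- 1) x < ereal t1 \<and> t1 \<le> t2 \<and> ereal t2 < exit_time \<Phi> \<Omega> 1 x \<longrightarrow>
          set_integrable lebesgue {t1..t2} (\<lambda>s. g (\<Phi> x s)) \<and>
          fs (\<Phi> x t1) - fs (\<Phi> x t2) = (LINT s:{t1..t2}|lebesgue. g (\<Phi> x s))"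
    using assms(10) unfolding sharp_rep_def g_def by blast
  have space\<nu>: "space \<nu> = Gamma \<Phi> \<Omega> \<sigma>" and sets\<nu>: "sets \<nu> = sets (restrict_space borel (Gamma \<Phi> \<Omega> \<sigma>))"
    using bm by (auto simp: boundary_measure_def)
  have borel\<nu>: "h \<in> borel_measurable \<nu>" if "h \<in> borel_measurable borel" for h :: "real ^ 'n \<Rightarrow> real"
    using measurable_restrict_space1[OF that] measurable_cong_sets[OF sets\<nu> refl] by blast
  have AEy: "AE y in \<nu>. trace_exists \<Phi> \<sigma> fs y \<and>
      T y * \<bar>flow_trace \<Phi> \<sigma> fs y\<bar> powr p \<le> 2 powr (p - 1) * (I f0 y + I g0 y) \<and>
      flow_trace \<Phi> \<sigma> fs y = B y"
    using AE_space slices[OF fs_f0] slices[OF g_g0] slices[OF sharp]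
      boundary_measureD(1)[OF bm f0p] boundary_measureD(1)[OF bm g0p]
  proof eventually_elim
    case (elim y)
    have pos: "0 < exit_time \<Phi> \<Omega> (- \<sigma>) y"
      by (rule Gamma_exit_time_pos[OF \<Omega>]) (use elim(1) space\<nu> in simp)
    show ?case
      unfolding T_def I_def B_def D_def
      using trace_on_slice[OF \<sigma> p pos f0 g0 elim(2-4)[unfolded D_def] elim(5,6)] by blast
  qed
  have T_meas [measurable]: "T \<in> borel_measurable borel"
    unfolding T_def using exit_time_measurable[OF \<Omega>, of "- \<sigma>"] by measurable
  have B\<nu> [measurable]: "B \<in> borel_measurable \<nu>"
    unfolding B_def by (intro borel\<nu> slice_average_measurable f0 g0 T_meas)
  have T\<nu> [measurable]: "T \<in> borel_measurable \<nu>" by (rule borel\<nu>[OF T_meas])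
  have T0: "0 \<le> T y" for y
    unfolding T_def using exit_time_nonneg[of \<Omega> "- \<sigma>" y] by (simp add: real_of_ereal_pos)
  have xi: "xi \<Phi> \<Omega> \<sigma> \<nu> = density \<nu> (\<lambda>y. ennreal (T y))"
  proof -
    have "e2ennreal (min (exit_time \<Phi> \<Omega> (- \<sigma>) y) 1) = ennreal (T y)" for y
      unfolding T_def using exit_time_nonneg[of \<Omega> "- \<sigma>" y]
      by (cases "exit_time \<Phi> \<Omega> (- \<sigma>) y") (auto simp: min_def simp flip: e2ennreal_ereal one_ereal_def)
    then show ?thesis unfolding xi_def by simp
  qed
  have B\<xi>: "B \<in> borel_measurable (xi \<Phi> \<Omega> \<sigma> \<nu>)" unfolding xi by simp
  have eq: "AE y in xi \<Phi> \<Omega> \<sigma> \<nu>. flow_trace \<Phi> \<sigma> fs y = B y"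
    unfolding xi using AEy by (subst AE_density) (auto elim: eventually_mono)
  have I_int: "integrable \<nu> (I f0)" "integrable \<nu> (I g0)"
    unfolding I_def D_def by (rule boundary_measureD(2)[OF bm f0p] boundary_measureD(2)[OF bm g0p])+
  have I_le: "(LINT y|\<nu>. I f0 y) \<le> Lp_norm p (restrict_space \<mu> \<Omega>) f powr p"
    "(LINT y|\<nu>. I g0 y) \<le> Lp_norm p (restrict_space \<mu> \<Omega>) g powr p"
    using boundary_measure_slice_integral_le[OF bm f0p] boundary_measure_slice_integral_le[OF bm g0p]
    unfolding f0n g0n I_def D_def by auto
  \<comment> \<open>The pointwise bound serves twice: it yields integrability, and then the norm estimate.\<close>
  have dom: "AE y in \<nu>. T y * \<bar>B y\<bar> powr p \<le> 2 powr (p - 1) * (I f0 y + I g0 y)"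
    using AEy by eventually_elim auto
  have dom_int: "integrable \<nu> (\<lambda>y. 2 powr (p - 1) * (I f0 y + I g0 y))"
    using I_int by simp
  have B_int: "integrable \<nu> (\<lambda>y. T y * \<bar>B y\<bar> powr p)"
    by (rule Bochner_Integration.integrable_bound[OF dom_int])
       (use dom T0 in \<open>auto elim!: eventually_mono intro: order.trans[OF _ abs_ge_self]\<close>)
  have "integrable (xi \<Phi> \<Omega> \<sigma> \<nu>) (\<lambda>y. \<bar>B y\<bar> powr p)"
    unfolding xi by (subst integrable_density) (use B_int T0 in auto)
  then have Lp: "flow_trace \<Phi> \<sigma> fs \<in> Lp p (xi \<Phi> \<Omega> \<sigma> \<nu>)"
    using Lp_iff_of_AE_eq[OF B\<xi> eq] by blast
  have "Lp_norm p (xi \<Phi> \<Omega> \<sigma> \<nu>) (flow_trace \<Phi> \<sigma> fs) powr p = (LINT y|xi \<Phi> \<Omega> \<sigma> \<nu>. \<bar>B y\<bar> powr p)"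
    by (rule Lp_norm_of_AE_eq[OF B\<xi> eq p0])
  also have "\<dots> = (LINT y|\<nu>. T y * \<bar>B y\<bar> powr p)"
    unfolding xi by (subst integral_density) (use T0 in auto)
  also have "\<dots> \<le> (LINT y|\<nu>. 2 powr (p - 1) * (I f0 y + I g0 y))"
    by (rule integral_mono_AE[OF B_int dom_int dom])
  also have "\<dots> = 2 powr (p - 1) * ((LINT y|\<nu>. I f0 y) + (LINT y|\<nu>. I g0 y))"
    using I_int by simp
  also have "\<dots> \<le> 2 powr (p - 1) * (Lp_norm p (restrict_space \<mu> \<Omega>) f powr p
                               + Lp_norm p (restrict_space \<mu> \<Omega>) g powr p)"
    by (intro mult_left_mono add_mono I_le) simp
  finally show ?thesis using AEy Lp unfolding g_def by (auto elim: eventually_mono)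
qed

end
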